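(* For every integer $N \ge 6$, $$Q(N,2,=) = N- \left \lfloor \frac{N+1}{3} \right \rfloor.$$
   Context: There are $N$ balls $b_1,\dots,b_N$, each colored red or green, with strictly fewer green than red balls (a Red-green coloring). For an integer $0\le p<\frac N2$, the coloring is $p$-equal if exactly $p$ balls are green. A comparison consists of choosing two balls and being told whether or not they have the same color (only "same" or "different" is answered). A method is an adaptive deterministic strategy: each comparison may depend on the answers to the previous ones. $Q(N,p,=)$ is the minimum integer $k$ such that there exists a method which, for every $p$-equal Red-green coloring of the $N$ balls (it being known in advance that the coloring is $p$-equal), determines for sure the color of every ball after at most $k$ comparisons. *)

theory Defs imports Complex_Main begin

datatype color = Red | Green

text \<open>The balls are the natural numbers below \<open>N\<close>; values of a coloring elsewhere are
  irrelevant.\<close>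

type_synonym coloring = "nat \<Rightarrow> color"

definition balls_of :: "nat \<Rightarrow> coloring \<Rightarrow> color \<Rightarrow> nat set" where
  "balls_of N c x = {i. i < N \<and> c i = x}"

definition red_green_coloring :: "nat \<Rightarrow> coloring \<Rightarrow> bool" where
  "red_green_coloring N c \<longleftrightarrow> card (balls_of N c Green) < card (balls_of N c Red)"

definition p_equal :: "nat \<Rightarrow> nat \<Rightarrow> coloring \<Rightarrow> bool" where
  "p_equal N p c \<longleftrightarrow> red_green_coloring N c \<and> card (balls_of N c Green) = p"

text \<open>An adaptive deterministic strategy is a decision tree: \<open>Compare i j s d\<close> compares the balls
  \<open>i\<close> and \<open>j\<close> and continues with \<open>s\<close> if the answer is ``same'' and with \<open>d\<close> if it is
  ``different''; \<open>Announce g\<close> stops and claims that every ball \<open>i\<close> has color \<open>g i\<close>.\<close>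

datatype strategy =
    Announce coloring
  | Compare nat nat strategy strategy

fun legal :: "nat \<Rightarrow> strategy \<Rightarrow> bool" where
  "legal N (Announce g) \<longleftrightarrow> True"
| "legal N (Compare i j s d) \<longleftrightarrow> i < N \<and> j < N \<and> i \<noteq> j \<and> legal N s \<and> legal N d"

fun announced :: "strategy \<Rightarrow> coloring \<Rightarrow> coloring" where
  "announced (Announce g) c = g"
| "announced (Compare i j s d) c = announced (if c i = c j then s else d) c"

fun comparisons :: "strategy \<Rightarrow> coloring \<Rightarrow> nat" where
  "comparisons (Announce g) c = 0"
| "comparisons (Compare i j s d) c = Suc (comparisons (if c i = c j then s else d) c)"

definition solves :: "nat \<Rightarrow> nat \<Rightarrow> nat \<Rightarrow> strategy \<Rightarrow> bool" where
  "solves N p k t \<longleftrightarrow> legal N t \<and>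
     (\<forall>c. p_equal N p c \<longrightarrow> (\<forall>i<N. announced t c i = c i) \<and> comparisons t c \<le> k)"

text \<open>For \<open>2 * p < N\<close> a solving strategy exists: comparing ball \<open>0\<close> with all other balls
  determines the coloring up to exchanging the colors, and the majority color is red.\<close>

definition Q :: "nat \<Rightarrow> nat \<Rightarrow> nat" where
  "Q N p = (LEAST k. \<exists>t. solves N p k t)"

end

theory Submission imports Defs begin

text \<open>The coloring is the same thing as its set of green balls, so a method has to pin down an
  unknown two-element set \<open>A\<close>; comparing \<open>i\<close> and \<open>j\<close> tells whether \<open>A\<close> contains exactly one of
  them. The right-hand side equals \<open>(2 * N + 1) div 3\<close>.

  Lower bound (\<open>adversary_bound\<close>). As long as all answers are ``same'', balls not yet compared
  are \<^emph>\<open>singles\<close>, balls compared only with each other form \<^emph>\<open>doubles\<close>, and all balls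
  linked in larger groups are red. The set \<open>A\<close> consists of two singles or is a double. With \<open>s\<close>
  singles and \<open>t\<close> doubles, one more answer ``same'' decreases \<open>2 * s + t\<close> by at most \<open>3\<close>.
  When \<open>2 * s + t\<close> has dropped into the range from 6 to 8, counting the remaining candidates shows
  that \<open>k\<close> further comparisons suffice only if \<open>2 * s + t \<le> 3 * k + 1\<close>. By induction this
  inequality holds for all larger values as well, in particular for \<open>s = N\<close> and \<open>t = 0\<close>.

  Upper bound (\<open>identifiable_pairs\<close>). Spending two comparisons \<open>a\<close>-\<open>b\<close> and \<open>b\<close>-\<open>c\<close> on three balls
  shows that they are all red, if both answers are ``same''; this pays for the decrease by two
  of the bound when \<open>N\<close> drops by three (\<open>identifiable_red_triple\<close>). An answer ``different''
  locates one green ball up to few possibilities, and a search that tests two balls per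
  comparison finds the other one in about \<open>N / 2\<close> further comparisons, which is within the bound
  (\<open>identifiable_joins_singleton\<close>, \<open>identifiable_joins_pair\<close>). The reduction ends with three or four
  unresolved balls and a known red ball, or with eight balls, where comparing disjoint pairs
  attains the bound (\<open>identifiable_pairs_8\<close>).\<close>

section \<open>Strategies as searches in a family of green sets\<close>

text \<open>\<open>E\<close> is the family of sets of green balls still possible. Working with this relation instead of
  decision trees lets both bounds be proved by induction over families of sets.\<close>

inductive identifiable :: "nat \<Rightarrow> nat \<Rightarrow> nat set set \<Rightarrow> bool" for N where
  known: "(\<And>A B. A \<in> E \<Longrightarrow> B \<in> E \<Longrightarrow> A = B) \<Longrightarrow> identifiable N k E"
| compare: "i < N \<Longrightarrow> j < N \<Longrightarrow> i \<noteq> j \<Longrightarrow>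
    identifiable N k {A \<in> E. i \<in> A \<longleftrightarrow> j \<in> A} \<Longrightarrow>
    identifiable N k {A \<in> E. i \<in> A \<longleftrightarrow> j \<notin> A} \<Longrightarrow> identifiable N (Suc k) E"

definition solves_family :: "nat \<Rightarrow> nat \<Rightarrow> nat set set \<Rightarrow> strategy \<Rightarrow> bool" where
  "solves_family N k E t \<longleftrightarrow> legal N t \<and>
     (\<forall>c. balls_of N c Green \<in> E \<longrightarrow> (\<forall>i<N. announced t c i = c i) \<and> comparisons t c \<le> k)"

lemma same_color_iff:
  assumes "i < N" "j < N"
  shows "c i = c j \<longleftrightarrow> (i \<in> balls_of N c Green \<longleftrightarrow> j \<in> balls_of N c Green)"
  using assms by (cases "c i"; cases "c j") (auto simp: balls_of_def)

lemma obtain_coloring: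
  assumes "A \<subseteq> {..<N}"
  obtains c where "balls_of N c Green = A"
proof
  show "balls_of N (\<lambda>i. if i \<in> A then Green else Red) Green = A"
    using assms by (auto simp: balls_of_def)
qed

text \<open>Each node of a decision tree splits the family by its answer. A leaf commits to one coloring,
  so at most one candidate can reach it.\<close>

lemma solves_family_imp_identifiable:
  assumes "E \<subseteq> Pow {..<N}" "solves_family N k E t"
  shows "identifiable N k E"
  using assms
proof (induction t arbitrary: k E)
  case (Announce g)
  have "A = {i. i < N \<and> g i = Green}" if "A \<in> E" for A
  proof -
    have "A \<subseteq> {..<N}" using that Announce.prems(1) by auto
    then obtain c where c: "balls_of N c Green = A" by (rule obtain_coloring)
    then have "\<forall>i<N. g i = c i"
      using Announce.prems(2) that by (simp add: solves_family_def)
    then show ?thesis using c by (auto simp: balls_of_def)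
  qed
  then show ?case by (blast intro: known)
next
  case (Compare i j s d)
  show ?case
  proof (cases "E = {}")
    case True
    then show ?thesis by (auto intro: known)
  next
    case False
    then obtain A where A: "A \<in> E" by blast
    then have "A \<subseteq> {..<N}" using Compare.prems(1) by auto
    then obtain c where c: "balls_of N c Green = A" by (rule obtain_coloring)
    have "comparisons (Compare i j s d) c \<le> k"
      using Compare.prems(2) c A unfolding solves_family_def by blast
    then obtain k' where k: "k = Suc k'" by (cases k) auto
    have ij: "i < N" "j < N" "i \<noteq> j" and leg: "legal N s" "legal N d"
      using Compare.prems(2) by (auto simp: solves_family_def)
    have ok: "(\<forall>l<N. announced (Compare i j s d) c l = c l) \<and> comparisons (Compare i j s d) c \<le> k"
      if "balls_of N c Green \<in> E" for c
      using Compare.prems(2) that unfolding solves_family_def by blast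
    note same = same_color_iff[OF ij(1,2)]
    have "solves_family N k' {A \<in> E. i \<in> A \<longleftrightarrow> j \<in> A} s"
      unfolding solves_family_def
    proof (intro conjI leg allI impI)
      fix c assume "balls_of N c Green \<in> {A \<in> E. i \<in> A \<longleftrightarrow> j \<in> A}"
      then have "(\<forall>l<N. announced s c l = c l) \<and> comparisons s c \<le> k'"
        using ok[of c] same[of c] k by simp
      then show "comparisons s c \<le> k'" and "\<And>l. l < N \<Longrightarrow> announced s c l = c l" by auto
    qed
    moreover have "solves_family N k' {A \<in> E. i \<in> A \<longleftrightarrow> j \<notin> A} d"
      unfolding solves_family_def
    proof (intro conjI leg allI impI)
      fix c assume "balls_of N c Green \<in> {A \<in> E. i \<in> A \<longleftrightarrow> j \<notin> A}"
      then have "(\<forall>l<N. announced d c l = c l) \<and> comparisons d c \<le> k'"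
        using ok[of c] same[of c] k by auto
      then show "comparisons d c \<le> k'" and "\<And>l. l < N \<Longrightarrow> announced d c l = c l" by auto
    qed
    ultimately show ?thesis
      unfolding k using Compare.prems(1)
      by (intro compare[OF ij] Compare.IH) auto
  qed
qed

lemma identifiable_imp_solves_family:
  assumes "identifiable N k E"
  shows "\<exists>t. solves_family N k E t"
  using assms
proof induction
  case (known E k)
  \<comment> \<open>If \<open>E\<close> is empty, the arbitrary value of \<open>SOME\<close> is harmless: no coloring is to be recognized.\<close>
  define g where "g = (\<lambda>i. if i \<in> (SOME A. A \<in> E) then Green else Red)"
  have "g i = c i" if c: "balls_of N c Green \<in> E" and i: "i < N" for c i
  proof -
    have "(SOME A. A \<in> E) = balls_of N c Green"
      using known[OF _ c] c by (metis someI)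
    then show ?thesis
      using i by (cases "c i") (auto simp: g_def balls_of_def)
  qed
  then have "solves_family N k E (Announce g)"
    by (simp add: solves_family_def)
  then show ?case ..
next
  case (compare i j k E)
  then obtain s d where
    "solves_family N k {A \<in> E. i \<in> A \<longleftrightarrow> j \<in> A} s"
    "solves_family N k {A \<in> E. i \<in> A \<longleftrightarrow> j \<notin> A} d" by blast
  then have "solves_family N (Suc k) E (Compare i j s d)"
    using compare.hyps(1-3) same_color_iff[OF compare.hyps(1,2)]
    unfolding solves_family_def by auto
  then show ?case ..
qed

definition pairs :: "nat set \<Rightarrow> nat set set" where
  "pairs M = {{u, v} |u v. u \<in> M \<and> v \<in> M \<and> u \<noteq> v}"

lemma pairs_eq: "pairs M = {A. A \<subseteq> M \<and> card A = 2}"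
  by (auto simp: pairs_def card_2_iff)

text \<open>Below half of the balls, the requirement of a red majority follows from the number of green
  balls.\<close>

lemma p_equal_iff:
  assumes "2 * p < N"
  shows "p_equal N p c \<longleftrightarrow> card (balls_of N c Green) = p"
proof -
  have "i \<in> balls_of N c Green \<union> balls_of N c Red \<longleftrightarrow> i \<in> {..<N}" for i
    by (cases "c i") (simp_all add: balls_of_def)
  then have "balls_of N c Green \<union> balls_of N c Red = {..<N}"
    by (rule set_eqI)
  moreover have "card (balls_of N c Green \<union> balls_of N c Red)
      = card (balls_of N c Green) + card (balls_of N c Red)"
    by (rule card_Un_disjoint) (auto simp: balls_of_def)
  ultimately have "card (balls_of N c Green) + card (balls_of N c Red) = N"
    by (metis card_lessThan)
  then show ?thesis
    using assms unfolding p_equal_def red_green_coloring_def by linarith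
qed

lemma solves_2_iff_identifiable:
  assumes "N \<ge> 5"
  shows "(\<exists>t. solves N 2 k t) \<longleftrightarrow> identifiable N k (pairs {..<N})"
proof -
  have "balls_of N c Green \<subseteq> {..<N}" for c
    by (auto simp: balls_of_def)
  moreover have "2 * 2 < N" using assms by simp
  ultimately have "p_equal N 2 c \<longleftrightarrow> balls_of N c Green \<in> pairs {..<N}" for c
    by (simp only: p_equal_iff pairs_eq mem_Collect_eq simp_thms)
  then have "solves N 2 k t \<longleftrightarrow> solves_family N k (pairs {..<N}) t" for t
    by (simp only: solves_def solves_family_def)
  moreover have "pairs {..<N} \<subseteq> Pow {..<N}"
    by (auto simp: pairs_def)
  ultimately show ?thesis
    by (metis solves_family_imp_identifiable identifiable_imp_solves_family)
qed

section \<open>The lower bound\<close>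

text \<open>The information-theoretic bound: each comparison has two answers.\<close>

lemma identifiable_card_le:
  "identifiable N k E \<Longrightarrow> finite E \<and> card E \<le> 2 ^ k"
proof (induction rule: identifiable.induct)
  case (known E k)
  have fin: "finite E"
  proof (cases "E = {}")
    case False
    then obtain A where "A \<in> E" by blast
    then have "E \<subseteq> {A}" using known by blast
    then show ?thesis by (rule finite_subset) simp
  qed simp
  moreover have "card E \<le> 1"
    unfolding One_nat_def card_le_Suc0_iff_eq[OF fin] using known by blast
  moreover have "(1::nat) \<le> 2 ^ k" by simp
  ultimately show ?case by linarith
next
  case (compare i j k E)
  have E: "{A \<in> E. i \<in> A \<longleftrightarrow> j \<in> A} \<union> {A \<in> E. i \<in> A \<longleftrightarrow> j \<notin> A} = E" by auto
  have "finite ({A \<in> E. i \<in> A \<longleftrightarrow> j \<in> A} \<union> {A \<in> E. i \<in> A \<longleftrightarrow> j \<notin> A})"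
    by (intro finite_UnI conjunct1[OF compare.IH(1)] conjunct1[OF compare.IH(2)])
  then have "finite E" unfolding E .
  moreover have "card E \<le> card {A \<in> E. i \<in> A \<longleftrightarrow> j \<in> A} + card {A \<in> E. i \<in> A \<longleftrightarrow> j \<notin> A}"
    using card_Un_le[of "{A \<in> E. i \<in> A \<longleftrightarrow> j \<in> A}" "{A \<in> E. i \<in> A \<longleftrightarrow> j \<notin> A}"]
    unfolding E .
  ultimately show ?case
    using compare.IH[THEN conjunct2] unfolding power_Suc by (intro conjI) linarith+
qed

lemma card_pairs: "finite M \<Longrightarrow> card (pairs M) = card M choose 2"
  by (simp add: pairs_eq n_subsets)

lemma card_pairs_Un:
  assumes "finite S" "finite T" "\<And>A. A \<in> T \<Longrightarrow> A \<inter> S = {}"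
  shows "card (pairs S \<union> T) = (card S choose 2) + card T"
proof -
  have "pairs S \<inter> T = {}"
    using assms(3) by (fastforce simp: pairs_def)
  moreover have "finite (pairs S)"
    using assms(1) by (simp add: pairs_eq)
  ultimately show ?thesis
    using assms by (simp add: card_Un_disjoint card_pairs)
qed

text \<open>For the values 6, 7 and 8 of \<open>2 * s + t\<close> there are at least 3, 3 and 5 candidates, so at
  least 2, 2 and 3 comparisons are needed. Below 6 the bound may fail: for \<open>s = 2\<close> and \<open>t = 1\<close>
  there are two candidates, which a single comparison with a known red ball separates, although \<open>2 * s + t = 5\<close>. This is why
  the adversary stops at 6.\<close>

lemma counting_bound:
  fixes s t k :: nat
  assumes "6 \<le> 2 * s + t" "2 * s + t \<le> 8" "(s choose 2) + t \<le> 2 ^ k"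
  shows "2 * s + t \<le> 3 * k + 1"
proof -
  have "s = 0 \<or> s = 1 \<or> s = 2 \<or> s = 3 \<or> s = 4"
    using assms(2) by linarith
  moreover have "k = 0 \<or> k = 1 \<or> k = 2 \<or> k \<ge> 3" by linarith
  ultimately show ?thesis
    using assms by (elim disjE) (simp_all add: choose_two)
qed

lemma card_containing_le:
  assumes "finite T" "pairwise disjnt T"
  shows "card {A \<in> T. i \<in> A} \<le> 1"
proof -
  have fin: "finite {A \<in> T. i \<in> A}" using assms(1) by simp
  show ?thesis
    unfolding One_nat_def card_le_Suc0_iff_eq[OF fin]
    using assms(2) unfolding pairwise_def disjnt_iff by blast
qed

text \<open>\<open>S\<close> holds the singles and \<open>T\<close> the doubles. From 9 on the adversary answers ``same'': comparing
  two singles turns them into a double (\<open>- 4 + 1\<close>), comparing a single with a ball of a double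
  makes that single and that double red (\<open>- 2 - 1\<close>), and all other comparisons lose less. So the value stays at least 6,
  where the induction hypothesis or the counting bound applies.\<close>

lemma adversary_bound:
  assumes "identifiable N k E" "pairs S \<union> T \<subseteq> E" "finite S" "finite T"
    "\<And>A. A \<in> T \<Longrightarrow> A \<inter> S = {}" "pairwise disjnt T"
    "6 \<le> 2 * card S + card T"
  shows "2 * card S + card T \<le> 3 * k + 1"
  using assms
proof (induction arbitrary: S T)
  case (known E k)
  have "identifiable N 0 E" using known.hyps by (rule identifiable.known)
  then have "finite E \<and> card E \<le> 2 ^ 0" by (rule identifiable_card_le)
  then have "finite E" "card E \<le> 1" by simp_all
  then have "(card S choose 2) + card T \<le> 1"
    using card_mono[OF \<open>finite E\<close> known.prems(1)] card_pairs_Un[OF known.prems(2-4)] by linarith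
  moreover have "card S choose 2 \<ge> card S - 1"
    by (cases "card S") (simp_all add: numeral_2_eq_2)
  ultimately show ?case using known.prems(6) by linarith
next
  case (compare i j k E)
  note fin = compare.prems(2,3) and disj = compare.prems(4)
  show ?case
  proof (cases "2 * card S + card T \<le> 8")
    case True
    have "identifiable N (Suc k) E" using compare.hyps by (rule identifiable.compare)
    then have E: "finite E \<and> card E \<le> 2 ^ Suc k" by (rule identifiable_card_le)
    then have "card (pairs S \<union> T) \<le> 2 ^ Suc k"
      using card_mono[OF conjunct1[OF E] compare.prems(1)] by linarith
    then have "(card S choose 2) + card T \<le> 2 ^ Suc k"
      using card_pairs_Un[OF fin disj] by simp
    with compare.prems(6) True show ?thesis by (rule counting_bound)
  next
    case False
    \<comment> \<open>\<open>T0\<close> drops the doubles that meet the comparison; two singles compared become a new double.\<close>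
    define T0 where "T0 = {A \<in> T. i \<notin> A \<and> j \<notin> A}"
    define T' where "T' = (if i \<in> S \<and> j \<in> S then insert {i, j} T0 else T0)"
    have one: "card {A \<in> T. l \<in> A} \<le> (if l \<in> S then 0 else 1)" for l
    proof (cases "l \<in> S")
      case True
      then have "{A \<in> T. l \<in> A} = {}" using disj by blast
      then show ?thesis by (simp only: card.empty)
    qed (use card_containing_le[OF fin(2) compare.prems(5)] in simp)
    have "card T \<le> card (T0 \<union> {A \<in> T. i \<in> A} \<union> {A \<in> T. j \<in> A})"
      using fin by (intro card_mono) (auto simp: T0_def)
    also have "\<dots> \<le> card T0 + card {A \<in> T. i \<in> A} + card {A \<in> T. j \<in> A}"
      using card_Un_le[of "T0 \<union> {A \<in> T. i \<in> A}" "{A \<in> T. j \<in> A}"]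
        card_Un_le[of T0 "{A \<in> T. i \<in> A}"] by linarith
    finally have T: "card T \<le> card T0 + card {A \<in> T. i \<in> A} + card {A \<in> T. j \<in> A}" .
    have "card (S \<inter> {i, j}) = (if i \<in> S then 1 else 0) + (if j \<in> S then 1 else 0)"
      using compare.hyps(3) by (simp add: Int_insert_right)
    then have S: "card (S - {i, j}) + (if i \<in> S then 1 else 0) + (if j \<in> S then 1 else 0) = card S"
      using card_Int_Diff[OF fin(1), of "{i, j}"] by linarith
    have fT0: "finite T0" using fin by (simp add: T0_def)
    have "{i, j} \<notin> T0" by (auto simp: T0_def)
    then have T': "card T' = card T0 + (if i \<in> S \<and> j \<in> S then 1 else 0)"
      using fT0 by (simp add: T'_def)
    have ST: "2 * card S + card T \<le> 2 * card (S - {i, j}) + card T' + 3"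
      using T S T' one[of i] one[of j]
      by (cases "i \<in> S"; cases "j \<in> S"; simp only: if_True if_False simp_thms; linarith)
    have "2 * card (S - {i, j}) + card T' \<le> 3 * k + 1"
    proof (rule compare.IH(1))
      show "pairs (S - {i, j}) \<union> T' \<subseteq> {A \<in> E. (i \<in> A) = (j \<in> A)}"
        using compare.prems(1) compare.hyps(3)
        by (auto simp: pairs_def T'_def T0_def split: if_splits)
      show "finite (S - {i, j})" "finite T'" using fin fT0 by (auto simp: T'_def)
      show "A \<inter> (S - {i, j}) = {}" if "A \<in> T'" for A
        using that disj by (auto simp: T'_def T0_def split: if_splits)
      show "pairwise disjnt T'"
        using compare.prems(5)
        by (auto simp: T'_def T0_def pairwise_def disjnt_iff split: if_splits)
      show "6 \<le> 2 * card (S - {i, j}) + card T'" using ST False by linarith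
    qed
    then show ?thesis using ST by simp
  qed
qed

section \<open>Composing searches\<close>

lemma identifiable_subset:
  "identifiable N k E \<Longrightarrow> F \<subseteq> E \<Longrightarrow> identifiable N k F"
proof (induction arbitrary: F rule: identifiable.induct)
  case (known E k)
  show ?case
    by (rule identifiable.known, rule known.hyps) (use known.prems in \<open>auto\<close>)
next
  case (compare i j k E)
  show ?case
    by (rule identifiable.compare[OF compare.hyps(1-3)]; rule compare.IH) (use compare.prems in auto)
qed

lemma identifiable_mono:
  "identifiable N k E \<Longrightarrow> k \<le> l \<Longrightarrow> identifiable N l E"
proof (induction arbitrary: l rule: identifiable.induct)
  case (known E k)
  from known.hyps show ?case by (rule identifiable.known)
next
  case (compare i j k E)
  then obtain l' where l: "l = Suc l'" "k \<le> l'" by (cases l) auto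
  show ?case
    unfolding l(1) using l(2) by (intro identifiable.compare[OF compare.hyps(1-3)] compare.IH)
qed

text \<open>The form in which comparisons are used below: the two remaining families and the two costs
  may be replaced by upper estimates.\<close>

lemma identifiable_compareI:
  assumes "i < N" "j < N" "i \<noteq> j"
    and "identifiable N k S" "\<And>A. A \<in> E \<Longrightarrow> i \<in> A \<longleftrightarrow> j \<in> A \<Longrightarrow> A \<in> S"
    and "identifiable N l D" "\<And>A. A \<in> E \<Longrightarrow> i \<in> A \<longleftrightarrow> j \<notin> A \<Longrightarrow> A \<in> D"
    and "k < m" "l < m"
  shows "identifiable N m E"
proof -
  obtain m' where m: "m = Suc m'" "k \<le> m'" "l \<le> m'" using assms(8,9) by (cases m) auto
  have "identifiable N m' {A \<in> E. i \<in> A \<longleftrightarrow> j \<in> A}"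
    by (rule identifiable_subset[OF identifiable_mono[OF assms(4) m(2)]]) (use assms(5) in blast)
  moreover have "identifiable N m' {A \<in> E. i \<in> A \<longleftrightarrow> j \<notin> A}"
    by (rule identifiable_subset[OF identifiable_mono[OF assms(6) m(3)]]) (use assms(7) in blast)
  ultimately show ?thesis
    unfolding m(1) by (rule identifiable.compare[OF assms(1-3)])
qed

lemma identifiable_two:
  assumes "i < N" "j < N" "i \<noteq> j" "i \<in> A \<longleftrightarrow> j \<in> A" "i \<in> B \<longleftrightarrow> j \<notin> B" "0 < m"
  shows "identifiable N m {A, B}"
  by (rule identifiable_compareI[where k = 0 and l = 0 and S = "{A}" and D = "{B}", OF assms(1-3)])
    (use assms in \<open>auto intro: known\<close>)

section \<open>Searches with one green ball on each side\<close>

text \<open>For disjoint \<open>X\<close> and \<open>Y\<close>, the candidates with one green ball in \<open>X\<close> and one in \<open>Y\<close>.\<close>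

definition joins :: "nat set \<Rightarrow> nat set \<Rightarrow> nat set set" where
  "joins X Y = {{x, y} |x y. x \<in> X \<and> y \<in> Y}"

lemma joins_same:
  assumes "A \<in> joins Z X" "x \<in> A \<longleftrightarrow> y \<in> A" "x \<noteq> y" "x \<notin> Z" "y \<notin> Z"
  shows "A \<in> joins Z (X - {x, y})"
proof -
  obtain z v where A: "A = {z, v}" "z \<in> Z" "v \<in> X" using assms(1) by (auto simp: joins_def)
  then have "v \<noteq> x" "v \<noteq> y" using assms by auto
  then show ?thesis using A by (auto simp: joins_def)
qed

lemma joins_different:
  assumes "A \<in> joins Z X" "x \<in> A \<longleftrightarrow> y \<notin> A" "x \<notin> Z" "y \<notin> Z"
  shows "A \<in> joins Z {x, y}"
proof -
  obtain z v where A: "A = {z, v}" "z \<in> Z" "v \<in> X" using assms(1) by (auto simp: joins_def)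
  then have "v = x \<or> v = y" using assms by auto
  then show ?thesis using A by (auto simp: joins_def)
qed

lemma obtain_two_members:
  assumes "card X \<ge> 2"
  obtains x y where "x \<in> X" "y \<in> X" "x \<noteq> y" "card (X - {x, y}) = card X - 2"
proof -
  have "\<not> card X \<le> 1" using assms by linarith
  moreover have fin: "finite X" using assms by (metis card.infinite not_numeral_le_zero)
  ultimately obtain x y where xy: "x \<in> X" "y \<in> X" "x \<noteq> y"
    unfolding One_nat_def card_le_Suc0_iff_eq[OF fin] by blast
  then have "card (X - {x, y}) = card X - card {x, y}"
    by (intro card_Diff_subset) auto
  then show thesis using that xy by simp
qed

text \<open>The ball \<open>c\<close> is green, and exactly one ball of \<open>X\<close> is. If two balls of \<open>X\<close> agree, they are
  both red; if they differ, the known red ball \<open>r\<close> tells which of them is green.\<close>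

lemma identifiable_joins_singleton:
  assumes "X \<subseteq> {..<N}" "c \<notin> X" "r < N" "r \<notin> X" "r \<noteq> c"
  shows "identifiable N ((card X + 1) div 2) (joins {c} X)"
  using assms
proof (induction "card X" arbitrary: X rule: less_induct)
  case less
  have fin: "finite X" using less.prems(1) finite_subset by blast
  show ?case
  proof (cases "card X \<le> 1")
    case True
    then have "\<forall>x\<in>X. \<forall>y\<in>X. x = y"
      unfolding One_nat_def card_le_Suc0_iff_eq[OF fin] .
    then show ?thesis by (intro known) (unfold joins_def, blast)
  next
    case False
    then have "2 \<le> card X" by linarith
    then obtain x y where xy: "x \<in> X" "y \<in> X" "x \<noteq> y"
      and card: "card (X - {x, y}) = card X - 2"
      by (rule obtain_two_members)
    have N: "x < N" "y < N" using xy less.prems(1) by auto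
    have c: "x \<notin> {c}" "y \<notin> {c}" using xy less.prems(2) by auto
    have "identifiable N 1 {{c, y}, {c, x}}"
      by (rule identifiable_two[of r _ x]) (use less.prems xy N in auto)
    then have two: "identifiable N 1 (joins {c} {x, y})"
      by (rule identifiable_subset) (auto simp: joins_def)
    show ?thesis
    proof (cases "card X = 2")
      case True
      then have "X - {x, y} = {}" using card fin by (metis card_0_eq diff_self_eq_0 finite_Diff)
      then have "X \<subseteq> {x, y}" by blast
      then have "joins {c} X \<subseteq> joins {c} {x, y}" unfolding joins_def by blast
      with two have "identifiable N 1 (joins {c} X)" by (rule identifiable_subset)
      then show ?thesis using True by simp
    next
      case neq: False
      with False have big: "3 \<le> card X" by arith
      have less_card: "card (X - {x, y}) < card X" using card False by linarith
      have IH: "identifiable N ((card (X - {x, y}) + 1) div 2) (joins {c} (X - {x, y}))"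
        by (rule less.hyps[OF less_card]) (use less.prems in auto)
      show ?thesis
        by (rule identifiable_compareI[OF N xy(3) IH joins_same[OF _ _ xy(3) c] two joins_different[OF _ _ c]])
          (assumption | use card big in linarith)+
    qed
  qed
qed

text \<open>Comparing one ball of each pair with the red ball \<open>r\<close> decides both pairs.\<close>

lemma identifiable_joins_two_two:
  assumes "distinct [a, b, x, y, r]" "set [a, b, x, y, r] \<subseteq> {..<N}"
  shows "identifiable N 2 (joins {a, b} {x, y})"
proof -
  have "identifiable N 1 {{u, y}, {u, x}}" if "u \<in> {a, b}" for u
    by (rule identifiable_two[of r _ x]) (use assms that in auto)
  then have a: "identifiable N 1 {{a, y}, {a, x}}" and b: "identifiable N 1 {{b, y}, {b, x}}"
    by simp_all
  show ?thesis
    by (rule identifiable_compareI[where i = r and j = a, OF _ _ _ b _ a])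
      (use assms in \<open>auto simp: joins_def\<close>)
qed

text \<open>Exactly one of \<open>a\<close>, \<open>b\<close> is green and exactly one ball of \<open>X\<close> is. The search discards two balls
  of \<open>X\<close> at a time. A red ball \<open>r\<close> is needed only to finish, when two compared balls of \<open>X\<close>
  differ or at most two are left. If \<open>X\<close> has at least three balls, the first comparison inside \<open>X\<close>
  produces one: the compared balls if they agree, any third ball of \<open>X\<close> if they differ.
  Therefore \<open>r\<close> may lie in \<open>X\<close> in that case.\<close>

lemma identifiable_joins_pair:
  assumes "X \<subseteq> {..<N}" "a \<notin> X" "b \<notin> X" "a < N" "b < N" "a \<noteq> b"
    and "r < N" "r \<noteq> a" "r \<noteq> b" "r \<notin> X \<or> card X \<ge> 3"
  shows "identifiable N ((card X + 3) div 2) (joins {a, b} X)"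
  using assms
proof (induction "card X" arbitrary: X r rule: less_induct)
  case less
  have fin: "finite X" using less.prems(1) finite_subset by blast
  consider "X = {}" | x where "X = {x}" | x y where "X = {x, y}" "x \<noteq> y" | "card X \<ge> 3"
  proof -
    have "card X = 0 \<or> card X = 1 \<or> card X = 2 \<or> card X \<ge> 3" by linarith
    then show thesis
      using that fin by (elim disjE) (simp, meson card_1_singletonE, meson card_2_iff, blast)
  qed
  then show ?case
  proof cases
    case 1
    then show ?thesis by (auto simp: joins_def intro: known)
  next
    case (2 x)
    have "joins {a, b} X = {{b, x}, {a, x}}" using 2 by (auto simp: joins_def)
    moreover have "identifiable N 2 {{b, x}, {a, x}}"
      by (rule identifiable_two[of r _ a]) (use less.prems 2 in auto)
    ultimately show ?thesis using 2 by simp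
  next
    case (3 x y)
    have "identifiable N 2 (joins {a, b} {x, y})"
      by (rule identifiable_joins_two_two[of _ _ _ _ r]) (use less.prems 3 in auto)
    then show ?thesis using 3 by simp
  next
    case 4
    then have "2 \<le> card X" by linarith
    then obtain x y where xy: "x \<in> X" "y \<in> X" "x \<noteq> y"
      and card: "card (X - {x, y}) = card X - 2"
      by (rule obtain_two_members)
    have N: "x < N" "y < N" using xy less.prems(1) by auto
    have ab: "x \<notin> {a, b}" "y \<notin> {a, b}" using xy less.prems(2,3) by auto
    have "X - {x, y} \<noteq> {}" using card 4 by force
    then obtain z where z: "z \<in> X" "z \<noteq> x" "z \<noteq> y" by blast
    have D: "identifiable N 2 (joins {a, b} {x, y})"
      by (rule identifiable_joins_two_two[of _ _ _ _ z]) (use less.prems xy z in auto)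
    have less_card: "card (X - {x, y}) < card X" using card 4 by linarith
    have IH: "identifiable N ((card (X - {x, y}) + 3) div 2) (joins {a, b} (X - {x, y}))"
      by (rule less.hyps[OF less_card, where r = x]) (use less.prems(1-6) N ab in auto)
    show ?thesis
      by (rule identifiable_compareI[OF N xy(3) IH joins_same[OF _ _ xy(3) ab] D joins_different[OF _ _ ab]])
        (assumption | use card 4 in linarith)+
  qed
qed

section \<open>Searching for two green balls\<close>

lemma pairs_same:
  assumes "A \<in> pairs M" "i \<in> A \<longleftrightarrow> j \<in> A" "i \<noteq> j"
  shows "A = {i, j} \<or> A \<in> pairs (M - {i, j})"
  using assms by (auto simp: pairs_def)

lemma pairs_different:
  assumes "A \<in> pairs M" "i \<in> A \<longleftrightarrow> j \<notin> A"
  shows "A \<in> joins {i, j} (M - {i, j})"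
  using assms by (auto simp: pairs_def joins_def insert_commute)

lemma identifiable_pairs_3:
  assumes "distinct [a, b, c, r]" "set [a, b, c, r] \<subseteq> {..<N}"
  shows "identifiable N 2 (pairs {a, b, c})"
proof -
  have D: "identifiable N 1 {{a, c}, {a, b}}"
    by (rule identifiable_two[of r _ b]) (use assms in auto)
  have S: "identifiable N 0 {{b, c}}" by (rule known) auto
  show ?thesis
    by (rule identifiable_compareI[where i = a and j = r, OF _ _ _ S _ D]) (use assms in \<open>auto simp: pairs_def\<close>)
qed

lemma identifiable_pairs_4:
  assumes "distinct [a, b, c, d, r]" "set [a, b, c, d, r] \<subseteq> {..<N}"
  shows "identifiable N 3 (pairs {a, b, c, d})"
proof -
  have D: "identifiable N 2 (joins {a, b} {c, d})"
    by (rule identifiable_joins_two_two[of _ _ _ _ r]) (use assms in auto)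
  have S: "identifiable N 1 {{c, d}, {a, b}}"
    by (rule identifiable_two[of r _ a]) (use assms in auto)
  show ?thesis
    by (rule identifiable_compareI[where i = a and j = b, OF _ _ _ S _ D])
      (use assms in \<open>auto simp: pairs_def joins_def\<close>)
qed

lemma identifiable_four_doubles:
  assumes "distinct [a, b, c, d, e, f, g, h]" "set [a, b, c, d, e, f, g, h] \<subseteq> {..<N}"
  shows "identifiable N 2 {{a, b}, {c, d}, {e, f}, {g, h}}"
proof -
  have S: "identifiable N 1 {{e, f}, {g, h}}"
    by (rule identifiable_two[of a _ g]) (use assms in auto)
  have D: "identifiable N 1 {{c, d}, {a, b}}"
    by (rule identifiable_two[of a _ e]) (use assms in auto)
  show ?thesis
    by (rule identifiable_compareI[where i = a and j = c, OF _ _ _ S _ D]) (use assms in auto)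
qed

text \<open>Reducing eight balls by a red triple would leave five with a budget of three comparisons, too
  few for ten candidates. Instead, disjoint pairs are compared. The first answer ``different'' leaves
  a joint search with the remaining balls; after three answers ``same'' four disjoint pairs remain.\<close>

lemma identifiable_pairs_8:
  assumes dist: "distinct [a, b, c, d, e, f, g, h]"
    and N: "set [a, b, c, d, e, f, g, h] \<subseteq> {..<N}"
  shows "identifiable N 5 (pairs {a, b, c, d, e, f, g, h})"
proof -
  have gh: "A = {g, h}" if "A \<in> pairs {g, h}" for A
    using that by (auto simp: pairs_def)
  have D3: "identifiable N 2 (joins {e, f} {g, h})"
    by (rule identifiable_joins_two_two[of _ _ _ _ a]) (use dist N in auto)
  have D2: "identifiable N 3 (joins {c, d} {e, f, g, h})"
    using identifiable_joins_pair[of "{e, f, g, h}" N c d a] dist N by simp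
  have D1: "identifiable N 4 (joins {a, b} {c, d, e, f, g, h})"
  proof -
    have "card {c, d, e, f, g, h} = 6" using dist by simp
    then show ?thesis
      using identifiable_joins_pair[of "{c, d, e, f, g, h}" N a b c] dist N by auto
  qed
  have *: "identifiable N 2 {{a, b}, {c, d}, {e, f}, {g, h}}"
    using dist N by (rule identifiable_four_doubles)
  have S2: "identifiable N 3 ({{a, b}, {c, d}} \<union> pairs {e, f, g, h})"
  proof (rule identifiable_compareI[where i = e and j = f, OF _ _ _ * _ D3])
    fix A assume "A \<in> {{a, b}, {c, d}} \<union> pairs {e, f, g, h}" "(e \<in> A) = (f \<in> A)"
    then show "A \<in> {{a, b}, {c, d}, {e, f}, {g, h}}"
      using pairs_same[of A "{e, f, g, h}" e f] dist gh by auto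
  next
    fix A assume "A \<in> {{a, b}, {c, d}} \<union> pairs {e, f, g, h}" "(e \<in> A) = (f \<notin> A)"
    then show "A \<in> joins {e, f} {g, h}"
      using pairs_different[of A "{e, f, g, h}" e f] dist by auto
  qed (use dist N in auto)
  have S1: "identifiable N 4 ({{a, b}} \<union> pairs {c, d, e, f, g, h})"
  proof (rule identifiable_compareI[where i = c and j = d, OF _ _ _ S2 _ D2])
    fix A assume "A \<in> {{a, b}} \<union> pairs {c, d, e, f, g, h}" "(c \<in> A) = (d \<in> A)"
    then show "A \<in> {{a, b}, {c, d}} \<union> pairs {e, f, g, h}"
      using pairs_same[of A "{c, d, e, f, g, h}" c d] dist by auto
  next
    fix A assume "A \<in> {{a, b}} \<union> pairs {c, d, e, f, g, h}" "(c \<in> A) = (d \<notin> A)"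
    then show "A \<in> joins {c, d} {e, f, g, h}"
      using pairs_different[of A "{c, d, e, f, g, h}" c d] dist by auto
  qed (use dist N in auto)
  show ?thesis
  proof (rule identifiable_compareI[where i = a and j = b, OF _ _ _ S1 _ D1])
    fix A assume "A \<in> pairs {a, b, c, d, e, f, g, h}" "(a \<in> A) = (b \<in> A)"
    then show "A \<in> {{a, b}} \<union> pairs {c, d, e, f, g, h}"
      using pairs_same[of A "{a, b, c, d, e, f, g, h}" a b] dist by auto
  next
    fix A assume "A \<in> pairs {a, b, c, d, e, f, g, h}" "(a \<in> A) = (b \<notin> A)"
    then show "A \<in> joins {a, b} {c, d, e, f, g, h}"
      using pairs_different[of A "{a, b, c, d, e, f, g, h}" a b] dist by auto
  qed (use dist N in auto)
qed

text \<open>The first comparison is \<open>a\<close>-\<open>b\<close>. If they differ, one of them is green and the other green ball is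
  among the remaining ones. If they agree, the second comparison is \<open>b\<close>-\<open>c\<close>. When \<open>b\<close> and \<open>c\<close> then
  differ, either \<open>a\<close> and \<open>b\<close> are the green balls or \<open>c\<close> is green together with a ball of \<open>X\<close>; comparing
  \<open>a\<close> with a ball \<open>x\<close> of \<open>X\<close> either leaves only \<open>{a, b}\<close> and \<open>{c, x}\<close> or shows that both \<open>a\<close> and
  \<open>x\<close> are red.\<close>

lemma identifiable_red_triple:
  assumes M: "M \<subseteq> {..<N}" and m: "card M \<ge> 6"
    and abc: "a \<in> M" "b \<in> M" "c \<in> M" "distinct [a, b, c]"
    and rest: "identifiable N ((2 * (card M - 3) + 1) div 3) (pairs (M - {a, b, c}))"
  shows "identifiable N ((2 * card M + 1) div 3) (pairs M)"
proof -
  define X where "X = M - {a, b, c}"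
  have fin: "finite M" using M finite_subset by blast
  have X: "card X = card M - 3"
    using abc fin by (simp add: X_def card_Diff_subset)
  have "2 \<le> card X" using X m by linarith
  then obtain x y where x: "x \<in> X" and y: "y \<in> X" "x \<noteq> y"
    by (rule obtain_two_members)
  have N: "a < N" "b < N" "c < N" "x < N" "y < N"
    using M abc x y by (auto simp: X_def)
  have notX: "a \<notin> X" "b \<notin> X" "c \<notin> X" by (auto simp: X_def)

  have two: "identifiable N 1 {{c, x}, {a, b}}"
    by (rule identifiable_two[of a _ y]) (use N x y notX abc in auto)
  have one: "identifiable N ((card (X - {x}) + 1) div 2) (joins {c} (X - {x}))"
    by (rule identifiable_joins_singleton[where r = a]) (use M N x abc in \<open>auto simp: X_def\<close>)
  have D2: "identifiable N ((2 * card M + 1) div 3 - 2) (insert {a, b} (joins {c} X))"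
    by (rule identifiable_compareI[OF N(1,4) _ one _ two])
      (use x abc notX X m fin in \<open>auto simp: joins_def X_def\<close>)

  have S1: "identifiable N ((2 * card M + 1) div 3 - 1) (insert {a, b} (pairs (M - {a, b})))"
  proof (rule identifiable_compareI[where i = b and j = c, OF _ _ _ rest _ D2])
    fix A assume A: "A \<in> insert {a, b} (pairs (M - {a, b}))"
    show "A \<in> pairs (M - {a, b, c})" if "(b \<in> A) = (c \<in> A)"
      using A that abc by (auto simp: pairs_def)
    show "A \<in> insert {a, b} (joins {c} X)" if "(b \<in> A) = (c \<notin> A)"
      using A that abc by (auto simp: pairs_def joins_def X_def)
  qed (use N abc m in auto)

  have ab: "card (M - {a, b}) = card M - 2"
    using abc fin by (simp add: card_Diff_subset)
  have D1: "identifiable N ((card (M - {a, b}) + 3) div 2) (joins {a, b} (M - {a, b}))"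
    by (rule identifiable_joins_pair[where r = c]) (use M N abc ab m in auto)
  show ?thesis
  proof (rule identifiable_compareI[OF N(1,2) _ S1 _ D1])
    show "a \<noteq> b" using abc by simp
    show "A \<in> insert {a, b} (pairs (M - {a, b}))" if "A \<in> pairs M" "(a \<in> A) = (b \<in> A)" for A
      using pairs_same[OF that \<open>a \<noteq> b\<close>] by simp
    show "A \<in> joins {a, b} (M - {a, b})" if "A \<in> pairs M" "(a \<in> A) = (b \<notin> A)" for A
      using that by (rule pairs_different)
    show "(2 * card M + 1) div 3 - 1 < (2 * card M + 1) div 3" using m by linarith
    show "(card (M - {a, b}) + 3) div 2 < (2 * card M + 1) div 3" unfolding ab using m by presburger
  qed
qed

text \<open>Six and seven balls reduce to three and four, which need a known red ball: a member of the
  triple just recognized serves. From nine on the reduction stays within the induction.\<close>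

lemma identifiable_pairs:
  assumes "M \<subseteq> {..<N}" "card M \<ge> 6"
  shows "identifiable N ((2 * card M + 1) div 3) (pairs M)"
  using assms
proof (induction "card M" arbitrary: M rule: less_induct)
  case less
  have fin: "finite M" using less.prems(1) finite_subset by blast
  then obtain xs where xs: "set xs = M" "distinct xs"
    using finite_distinct_list by blast
  have len: "length xs = card M"
    using distinct_card[OF xs(2)] unfolding xs(1) by (rule sym)
  have "3 \<le> length xs" using len less.prems(2) by linarith
  then obtain a b c ys where abc: "xs = a # b # c # ys"
    by (auto simp: numeral_3_eq_3 Suc_le_length_iff)
  have dist: "distinct (a # b # c # ys)" using xs(2) unfolding abc .
  have set: "M = set (a # b # c # ys)" using xs(1) unfolding abc by (rule sym)
  have sub: "set (a # b # c # ys) \<subseteq> {..<N}" using less.prems(1) unfolding set .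
  have rest: "M - {a, b, c} = set ys" unfolding set using dist by auto
  have len: "card M = length ys + 3" using len unfolding abc by simp
  have abc_M: "a \<in> M" "b \<in> M" "c \<in> M" "distinct [a, b, c]"
    unfolding set using dist by simp_all
  note triple = identifiable_red_triple[OF less.prems abc_M]
  consider "card M = 6" | "card M = 7" | "card M = 8" | "card M \<ge> 9"
    using less.prems(2) by linarith
  then show ?case
  proof cases
    case 1
    then have "length ys = 3" using len by linarith
    then obtain d e f where ys: "ys = [d, e, f]"
      by (auto simp: numeral_eq_Suc length_Suc_conv)
    have "identifiable N 2 (pairs {d, e, f})"
      by (rule identifiable_pairs_3[of _ _ _ a]) (use dist sub in \<open>auto simp: ys\<close>)
    moreover have "M - {a, b, c} = {d, e, f}" using rest ys by simp
    ultimately show ?thesis using triple 1 by simp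
  next
    case 2
    then have "length ys = 4" using len by linarith
    then obtain d e f g where ys: "ys = [d, e, f, g]"
      by (auto simp: numeral_eq_Suc length_Suc_conv)
    have "identifiable N 3 (pairs {d, e, f, g})"
      by (rule identifiable_pairs_4[of _ _ _ _ a]) (use dist sub in \<open>auto simp: ys\<close>)
    moreover have "M - {a, b, c} = {d, e, f, g}" using rest ys by simp
    ultimately show ?thesis using triple 2 by simp
  next
    case 3
    then have "length ys = 5" using len by linarith
    then obtain d e f g h where ys: "ys = [d, e, f, g, h]"
      by (auto simp: numeral_eq_Suc length_Suc_conv)
    have "identifiable N 5 (pairs {a, b, c, d, e, f, g, h})"
      by (rule identifiable_pairs_8) (use dist sub in \<open>simp_all only: ys\<close>)
    moreover have "M = {a, b, c, d, e, f, g, h}" unfolding set ys by simp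
    ultimately have "identifiable N 5 (pairs M)" by simp
    then show ?thesis using 3 by simp
  next
    case 4
    have card: "card (M - {a, b, c}) = card M - 3"
      unfolding rest using distinct_card[of ys] dist len by simp
    have less_card: "card (M - {a, b, c}) < card M" using card 4 by linarith
    have "identifiable N ((2 * card (M - {a, b, c}) + 1) div 3) (pairs (M - {a, b, c}))"
      by (rule less.hyps[OF less_card]) (use less.prems(1) card 4 in auto)
    then show ?thesis unfolding card by (rule triple)
  qed
qed

theorem proposition3:
  fixes N :: nat
  assumes "N \<ge> 6"
  shows "int (Q N 2) = int N - \<lfloor>real (N + 1) / 3\<rfloor>"
proof -
  have solves_iff: "(\<exists>t. solves N 2 k t) \<longleftrightarrow> identifiable N k (pairs {..<N})" for k
    using assms by (intro solves_2_iff_identifiable) linarith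
  have "Q N 2 = (2 * N + 1) div 3"
    unfolding Q_def
  proof (rule Least_equality)
    show "\<exists>t. solves N 2 ((2 * N + 1) div 3) t"
      using identifiable_pairs[of "{..<N}" N] assms unfolding solves_iff by simp
  next
    fix k assume "\<exists>t. solves N 2 k t"
    then have "identifiable N k (pairs {..<N})"
      unfolding solves_iff .
    from adversary_bound[OF this, of "{..<N}" "{}"] have "2 * N \<le> 3 * k + 1"
      using assms by simp
    then show "(2 * N + 1) div 3 \<le> k" by linarith
  qed
  moreover have "\<lfloor>real (N + 1) / 3\<rfloor> = int ((N + 1) div 3)"
    using floor_divide_of_nat_eq[of "N + 1" 3] by simp
  moreover have "int ((2 * N + 1) div 3) = int N - int ((N + 1) div 3)"
    by presburger
  ultimately show ?thesis by (simp only:)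
qed

end
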